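(* Let $X$ be a directed space. The following conditions are equivalent: (1) $X$ is core compact, i.e. $\mathcal O(X)$ is a continuous lattice; (2) $X\otimes Y=X\times Y$ for every directed space $Y$; (3) $\Sigma\mathcal O(X)\times X=\Sigma\mathcal O(X)\otimes X$.
   Context: Order notions on a $T_0$ space refer to the specialization order ($x\sqsubseteq y$ iff $x\in\overline{\{y\}}$). Directed sets are nonempty. A directed set $D\subseteq X$ converges to $x$ ($D\to x$) if $D$ meets every open neighbourhood of $x$. A subset $U\subseteq X$ of a $T_0$ space is directed-open if for every directed $D\subseteq X$ and $x\in X$ with $D\to x$ and $x\in U$ one has $D\cap U\ne\emptyset$. The directed-open sets form a $T_0$ topology $d(\mathcal O(X))\supseteq\mathcal O(X)$ with the same specialization order; write $\mathcal DX=(X,d(\mathcal O(X)))$. A $T_0$ space is a directed space if every directed-open set is open, i.e. $X=\mathcal DX$. $\mathcal O(X)$ is the lattice of open sets of $X$. For a poset $P$, $\Sigma P$ is $P$ with the Scott topology (it is a directed space). $X\times Y$ is the usual topological product and $X\otimes Y=\mathcal D(X\times Y)$ is the categorical product in the category of directed spaces; the equalities mean that the topologies on the common underlying set coincide. *)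

theory Defs
  imports "HOL-Analysis.Analysis" "HOL-Algebra.Complete_Lattice"
begin

section \<open>Directed spaces\<close>

text \<open>All topologies are abstract ones with their own carrier, so that a space and the
  lattice of its open sets can be treated alike, and products with spaces over other
  types make sense. The topology of directed-open sets and the Scott topology are
  introduced through \<^const>\<open>topology\<close>; the two \<open>istopology\<close> lemmas
  show that the families used really are topologies.\<close>

definition specialization_le :: "'a topology \<Rightarrow> 'a \<Rightarrow> 'a \<Rightarrow> bool" where
  "specialization_le X x y \<longleftrightarrow> x \<in> X closure_of {y}"

definition directed_subset :: "'a topology \<Rightarrow> 'a set \<Rightarrow> bool" where
  "directed_subset X D \<longleftrightarrow> D \<subseteq> topspace X \<and> D \<noteq> {} \<and>
     (\<forall>x\<in>D. \<forall>y\<in>D. \<exists>z\<in>D. specialization_le X x z \<and> specialization_le X y z)"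

definition converges_to :: "'a topology \<Rightarrow> 'a set \<Rightarrow> 'a \<Rightarrow> bool" where
  "converges_to X D x \<longleftrightarrow> x \<in> topspace X \<and> (\<forall>U. openin X U \<and> x \<in> U \<longrightarrow> D \<inter> U \<noteq> {})"

definition directed_open :: "'a topology \<Rightarrow> 'a set \<Rightarrow> bool" where
  "directed_open X U \<longleftrightarrow> U \<subseteq> topspace X \<and>
     (\<forall>D x. directed_subset X D \<and> converges_to X D x \<and> x \<in> U \<longrightarrow> D \<inter> U \<noteq> {})"

definition directed_topology :: "'a topology \<Rightarrow> 'a topology" where
  "directed_topology X = topology (directed_open X)"

definition directed_space :: "'a topology \<Rightarrow> bool" where
  "directed_space X \<longleftrightarrow> t0_space X \<and> (\<forall>U. directed_open X U \<longrightarrow> openin X U)"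

definition directed_product :: "'a topology \<Rightarrow> 'b topology \<Rightarrow> ('a \<times> 'b) topology" where
  "directed_product X Y = directed_topology (prod_topology X Y)"

lemma directed_openD:
  assumes "directed_open X U" "directed_subset X D" "converges_to X D x" "x \<in> U"
  obtains d where "d \<in> D" "d \<in> U"
proof -
  have "D \<inter> U \<noteq> {}"
    using assms unfolding directed_open_def by meson
  then show ?thesis
    using that by (meson disjoint_iff)
qed

lemma directed_open_upward:
  assumes "directed_open X U" "x \<in> U" "y \<in> topspace X" "specialization_le X x y"
  shows "y \<in> U"
proof -
  have "converges_to X {y} x"
    using assms(4) by (simp add: converges_to_def specialization_le_def in_closure_of)
  moreover have "directed_subset X {y}"
    using assms(3) by (simp add: directed_subset_def specialization_le_def in_closure_of)
  ultimately show ?thesis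
    using directed_openD[OF assms(1) _ _ assms(2)] by (metis singletonD)
qed

lemma istopology_directed_open: "istopology (directed_open X)"
  unfolding istopology_def
proof (intro conjI allI impI)
  fix U V assume U: "directed_open X U" and V: "directed_open X V"
  have "D \<inter> (U \<inter> V) \<noteq> {}"
    if D: "directed_subset X D" "converges_to X D x" and x: "x \<in> U" "x \<in> V" for D x
  proof -
    obtain u where u: "u \<in> D" "u \<in> U"
      using directed_openD[OF U D x(1)] .
    obtain v where v: "v \<in> D" "v \<in> V"
      using directed_openD[OF V D x(2)] .
    obtain w where w: "w \<in> D" "specialization_le X u w" "specialization_le X v w"
      using D(1) u(1) v(1) by (meson directed_subset_def)
    have "w \<in> topspace X"
      using D(1) w(1) by (meson directed_subset_def subsetD)
    then have "w \<in> U" "w \<in> V"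
      using directed_open_upward U V u(2) v(2) w(2,3) by metis+
    then show ?thesis
      using w(1) by (meson IntI disjoint_iff)
  qed
  moreover have "U \<inter> V \<subseteq> topspace X"
    using U by (simp add: directed_open_def le_infI1)
  ultimately show "directed_open X (U \<inter> V)"
    unfolding directed_open_def by (meson IntD1 IntD2)
next
  fix \<K> assume K: "\<forall>K\<in>\<K>. directed_open X K"
  have "D \<inter> \<Union>\<K> \<noteq> {}"
    if D: "directed_subset X D" "converges_to X D x" and x: "x \<in> \<Union>\<K>" for D x
  proof -
    obtain K where "K \<in> \<K>" "x \<in> K"
      using x by (rule UnionE)
    moreover obtain d where "d \<in> D" "d \<in> K"
      using directed_openD[OF bspec[OF K \<open>K \<in> \<K>\<close>] D \<open>x \<in> K\<close>] .
    ultimately show ?thesis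
      by (meson UnionI disjoint_iff)
  qed
  moreover have "\<Union>\<K> \<subseteq> topspace X"
    using K by (simp add: directed_open_def Union_least)
  ultimately show "directed_open X (\<Union>\<K>)"
    unfolding directed_open_def by meson
qed

lemma openin_directed_topology: "openin (directed_topology X) U \<longleftrightarrow> directed_open X U"
  unfolding directed_topology_def
  by (simp only: topology_inverse'[OF istopology_directed_open])

section \<open>Scott topology and continuous lattices\<close>

definition order_directed :: "('a, 'b) gorder_scheme \<Rightarrow> 'a set \<Rightarrow> bool" where
  "order_directed L D \<longleftrightarrow> D \<subseteq> carrier L \<and> D \<noteq> {} \<and>
     (\<forall>x\<in>D. \<forall>y\<in>D. \<exists>z\<in>D. x \<sqsubseteq>\<^bsub>L\<^esub> z \<and> y \<sqsubseteq>\<^bsub>L\<^esub> z)"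

text \<open>Posets are those of HOL-Algebra. A supremum occurs only as the relation
  \<^term>\<open>is_lub L s D\<close>, so directed sets without a supremum impose no condition.\<close>

definition scott_open :: "('a, 'b) gorder_scheme \<Rightarrow> 'a set \<Rightarrow> bool" where
  "scott_open L U \<longleftrightarrow> U \<subseteq> carrier L \<and>
     (\<forall>x\<in>U. \<forall>y\<in>carrier L. x \<sqsubseteq>\<^bsub>L\<^esub> y \<longrightarrow> y \<in> U) \<and>
     (\<forall>D s. order_directed L D \<and> is_lub L s D \<and> s \<in> U \<longrightarrow> D \<inter> U \<noteq> {})"

definition scott_topology :: "('a, 'b) gorder_scheme \<Rightarrow> 'a topology" where
  "scott_topology L = topology (scott_open L)"

definition way_below :: "('a, 'b) gorder_scheme \<Rightarrow> 'a \<Rightarrow> 'a \<Rightarrow> bool" where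
  "way_below L x y \<longleftrightarrow>
     (\<forall>D s. order_directed L D \<and> is_lub L s D \<and> y \<sqsubseteq>\<^bsub>L\<^esub> s \<longrightarrow> (\<exists>d\<in>D. x \<sqsubseteq>\<^bsub>L\<^esub> d))"

definition continuous_lattice :: "('a, 'b) gorder_scheme \<Rightarrow> bool" where
  "continuous_lattice L \<longleftrightarrow> complete_lattice L \<and>
     (\<forall>x\<in>carrier L. is_lub L x {y \<in> carrier L. way_below L y x})"

definition open_lattice :: "'a topology \<Rightarrow> 'a set gorder" where
  "open_lattice X = \<lparr>carrier = {U. openin X U}, eq = (=), le = (\<subseteq>)\<rparr>"

definition core_compact :: "'a topology \<Rightarrow> bool" where
  "core_compact X \<longleftrightarrow> continuous_lattice (open_lattice X)"

lemma istopology_scott_open: "istopology (scott_open L)"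
  unfolding istopology_def
proof (intro conjI allI impI)
  fix U V assume U: "scott_open L U" and V: "scott_open L V"
  have "D \<inter> (U \<inter> V) \<noteq> {}"
    if D: "order_directed L D" "is_lub L s D" and s: "s \<in> U" "s \<in> V" for D s
  proof -
    have "D \<inter> U \<noteq> {}" "D \<inter> V \<noteq> {}"
      using U V D s unfolding scott_open_def by meson+
    then obtain u v where uv: "u \<in> D" "u \<in> U" "v \<in> D" "v \<in> V"
      by (meson disjoint_iff)
    obtain w where w: "w \<in> D" "u \<sqsubseteq>\<^bsub>L\<^esub> w" "v \<sqsubseteq>\<^bsub>L\<^esub> w"
      using D(1) uv(1,3) by (meson order_directed_def)
    have "w \<in> carrier L"
      using D(1) w(1) by (meson order_directed_def subsetD)
    then have "w \<in> U" "w \<in> V"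
      using U V uv(2,4) w(2,3) by (meson scott_open_def)+
    then show ?thesis
      using w(1) by (meson IntI disjoint_iff)
  qed
  moreover have "U \<inter> V \<subseteq> carrier L"
    using U by (simp add: scott_open_def le_infI1)
  moreover have "y \<in> U \<inter> V"
    if "x \<in> U \<inter> V" "y \<in> carrier L" "x \<sqsubseteq>\<^bsub>L\<^esub> y" for x y
    using U V that by (meson scott_open_def IntD1 IntD2 IntI)
  ultimately show "scott_open L (U \<inter> V)"
    unfolding scott_open_def by (meson IntD1 IntD2)
next
  fix \<K> assume K: "\<forall>K\<in>\<K>. scott_open L K"
  have "D \<inter> \<Union>\<K> \<noteq> {}"
    if D: "order_directed L D" "is_lub L s D" and s: "s \<in> \<Union>\<K>" for D s
  proof -
    obtain K where "K \<in> \<K>" "s \<in> K"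
      using s by (rule UnionE)
    then have "D \<inter> K \<noteq> {}"
      using K D unfolding scott_open_def by meson
    then show ?thesis
      using \<open>K \<in> \<K>\<close> by (meson UnionI disjoint_iff)
  qed
  moreover have "\<Union>\<K> \<subseteq> carrier L"
    using K by (simp add: scott_open_def Union_least)
  moreover have "y \<in> \<Union>\<K>"
    if "x \<in> \<Union>\<K>" "y \<in> carrier L" "x \<sqsubseteq>\<^bsub>L\<^esub> y" for x y
    using K that by (meson scott_open_def UnionE UnionI)
  ultimately show "scott_open L (\<Union>\<K>)"
    unfolding scott_open_def by meson
qed

lemma openin_scott_topology: "openin (scott_topology L) U \<longleftrightarrow> scott_open L U"
  unfolding scott_topology_def
  by (simp only: topology_inverse'[OF istopology_scott_open])

end

theory Submission imports Defs begin

text \<open>If \<open>X\<close> is core compact and \<open>W\<close> is directed-open in \<open>X \<times> Y\<close>, every slice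
  \<open>W\<^sub>y = {x. (x, y) \<in> W}\<close> is open in \<open>X\<close>, and \<open>y \<mapsto> W\<^sub>y\<close> is continuous into \<open>\<Sigma>\<O>(X)\<close>. Given
  \<open>(x, y) \<in> W\<close>, choose \<open>U \<lless> W\<^sub>y\<close> with \<open>x \<in> U\<close>; by interpolation \<open>{V. U \<lless> V}\<close> is Scott open,
  so \<open>U \<times> {z. U \<lless> W\<^sub>z}\<close> is an open rectangle inside \<open>W\<close>. Conversely, the membership relation
  \<open>{(U, x). x \<in> U}\<close> is always directed-open in \<open>\<Sigma>\<O>(X) \<times> X\<close>. If it is open, then every
  \<open>x \<in> U\<close> lies in a rectangle \<open>H \<times> V\<close> with \<open>H\<close> Scott open, \<open>U \<in> H\<close> and \<open>V\<close> below every
  member of \<open>H\<close>, which forces \<open>V \<lless> U\<close>.\<close>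

section \<open>Directed-open sets\<close>

lemma specialization_le_iff:
  "specialization_le X x y \<longleftrightarrow> x \<in> topspace X \<and> (\<forall>U. openin X U \<and> x \<in> U \<longrightarrow> y \<in> U)"
  by (auto simp: specialization_le_def in_closure_of)

lemma specialization_le_continuous_map:
  assumes "continuous_map X Y f" "specialization_le X x y" "y \<in> topspace X"
  shows "specialization_le Y (f x) (f y)"
  unfolding specialization_le_iff
proof (intro conjI allI impI)
  show "f x \<in> topspace Y"
    using assms by (auto simp: specialization_le_iff continuous_map_def)
next
  fix U assume "openin Y U \<and> f x \<in> U"
  then have "openin X {z \<in> topspace X. f z \<in> U}" "f x \<in> U"
    using assms(1) by (auto simp: continuous_map_def)
  then show "f y \<in> U"
    using assms(2) unfolding specialization_le_iff by blast
qed

lemma openin_imp_directed_open: "openin X U \<Longrightarrow> directed_open X U"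
  unfolding directed_open_def converges_to_def by (meson openin_subset)

text \<open>Continuous maps preserve the specialization order, hence directed sets, and they
  preserve convergence. This is the functoriality of the directed topology; it is applied below to
  the swap of factors and to the inclusions of slices.\<close>

lemma directed_open_vimage:
  assumes f: "continuous_map X Y f" and U: "directed_open Y U"
  shows "directed_open X {x \<in> topspace X. f x \<in> U}"
  unfolding directed_open_def
proof (intro conjI allI impI)
  fix D x
  assume "directed_subset X D \<and> converges_to X D x \<and> x \<in> {x \<in> topspace X. f x \<in> U}"
  then have D: "directed_subset X D" and cv: "converges_to X D x" and x: "x \<in> topspace X" "f x \<in> U"
    by auto
  have "\<exists>z\<in>D. specialization_le Y (f a) (f z) \<and> specialization_le Y (f b) (f z)"
    if "a \<in> D" "b \<in> D" for a b
    using D that specialization_le_continuous_map[OF f] unfolding directed_subset_def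
    by (meson subsetD)
  moreover have "f ` D \<subseteq> topspace Y" "f ` D \<noteq> {}"
    using D f unfolding directed_subset_def continuous_map_def by auto
  ultimately have "directed_subset Y (f ` D)"
    unfolding directed_subset_def by auto
  moreover have "converges_to Y (f ` D) (f x)"
    unfolding converges_to_def
  proof (intro conjI allI impI)
    show "f x \<in> topspace Y"
      using x f by (auto simp: continuous_map_def)
  next
    fix V assume "openin Y V \<and> f x \<in> V"
    then have "openin X {z \<in> topspace X. f z \<in> V}" "f x \<in> V"
      using f by (auto simp: continuous_map_def)
    then have "D \<inter> {z \<in> topspace X. f z \<in> V} \<noteq> {}"
      using cv x unfolding converges_to_def by blast
    then show "f ` D \<inter> V \<noteq> {}"
      by auto
  qed
  ultimately obtain d where "d \<in> f ` D" "d \<in> U"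
    using directed_openD[OF U _ _ x(2)] by blast
  then show "D \<inter> {x \<in> topspace X. f x \<in> U} \<noteq> {}"
    using D unfolding directed_subset_def by auto
qed auto

text \<open>Open sets are always directed-open, so only one inclusion between the two topologies can
  fail.\<close>

lemma directed_topology_eq_iff:
  "directed_topology X = X \<longleftrightarrow> (\<forall>U. directed_open X U \<longrightarrow> openin X U)"
  unfolding topology_eq openin_directed_topology using openin_imp_directed_open by blast

text \<open>The swap of factors is a homeomorphism, and both kinds of openness pull back along it.
  Condition (2) has \<open>X\<close> as the left factor and condition (3) as the right one; this
  lemma connects them.\<close>

lemma directed_product_commute:
  assumes "directed_product X Y = prod_topology X Y"
  shows "directed_product Y X = prod_topology Y X"
  unfolding directed_product_def directed_topology_eq_iff
proof (intro allI impI)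
  fix W assume W: "directed_open (prod_topology Y X) W"
  have "directed_open (prod_topology X Y)
      {p \<in> topspace (prod_topology X Y). prod.swap p \<in> W}"
    by (rule directed_open_vimage[OF _ W])
      (simp add: prod.swap_def continuous_map_pairwise o_def continuous_map_fst continuous_map_snd)
  then have "openin (prod_topology X Y) {p \<in> topspace (prod_topology X Y). prod.swap p \<in> W}"
    using assms unfolding directed_product_def directed_topology_eq_iff by blast
  moreover have "continuous_map (prod_topology Y X) (prod_topology X Y) prod.swap"
    by (simp add: prod.swap_def continuous_map_pairwise o_def continuous_map_fst continuous_map_snd)
  ultimately have "openin (prod_topology Y X) {q \<in> topspace (prod_topology Y X).
      prod.swap q \<in> {p \<in> topspace (prod_topology X Y). prod.swap p \<in> W}}"
    by (rule openin_continuous_map_preimage[rotated])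
  \<comment> \<open>Swapping is an involution, so the double preimage gives back
    \<open>W\<close>.\<close>
  moreover have "{q \<in> topspace (prod_topology Y X).
      prod.swap q \<in> {p \<in> topspace (prod_topology X Y). prod.swap p \<in> W}} = W"
    using W by (auto simp: directed_open_def)
  ultimately show "openin (prod_topology Y X) W"
    by simp
qed

section \<open>The Scott topology\<close>

lemma topspace_scott_topology: "topspace (scott_topology L) = carrier L"
proof -
  have "scott_open L (carrier L)"
    by (auto simp: scott_open_def order_directed_def)
  then show ?thesis
    unfolding topspace_def openin_scott_topology by (auto simp: scott_open_def)
qed

context partial_order
begin

text \<open>If \<open>D\<close> missed this complement of a principal ideal, \<open>y\<close> would
  be an upper bound of \<open>D\<close> and hence lie above its supremum. These sets separate points
  and let the order be recovered from the topology.\<close>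

lemma scott_open_not_le:
  assumes "y \<in> carrier L"
  shows "scott_open L {z \<in> carrier L. \<not> z \<sqsubseteq> y}"
  unfolding scott_open_def
proof (intro conjI allI impI ballI)
  fix D s
  assume "order_directed L D \<and> is_lub L s D \<and> s \<in> {z \<in> carrier L. \<not> z \<sqsubseteq> y}"
  then have D: "D \<subseteq> carrier L" "is_lub L s D" "\<not> s \<sqsubseteq> y"
    by (auto simp: order_directed_def)
  show "D \<inter> {z \<in> carrier L. \<not> z \<sqsubseteq> y} \<noteq> {}"
  proof
    assume "D \<inter> {z \<in> carrier L. \<not> z \<sqsubseteq> y} = {}"
    then have "y \<in> Upper L D"
      using D(1) assms by (auto simp: Upper_def)
    then show False
      using D by (simp add: least_def)
  qed
next
  fix x z assume "x \<in> {z \<in> carrier L. \<not> z \<sqsubseteq> y}" "z \<in> carrier L" "x \<sqsubseteq> z"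
  then show "z \<in> {z \<in> carrier L. \<not> z \<sqsubseteq> y}"
    using assms le_trans by blast
qed auto

lemma specialization_le_scott_topology:
  "specialization_le (scott_topology L) x y \<longleftrightarrow> x \<in> carrier L \<and> y \<in> carrier L \<and> x \<sqsubseteq> y"
proof
  assume le: "specialization_le (scott_topology L) x y"
  then have x: "x \<in> carrier L"
    by (simp add: specialization_le_iff topspace_scott_topology)
  have "openin (scott_topology L) (carrier L)"
    using openin_topspace by (simp flip: topspace_scott_topology[of L])
  then have y: "y \<in> carrier L"
    using le x by (meson specialization_le_iff)
  \<comment> \<open>If this set were open and contained \<open>x\<close>, it would also contain
    \<open>y\<close>, against reflexivity.\<close>
  then have "\<not> scott_open L {z \<in> carrier L. \<not> z \<sqsubseteq> y} \<or> x \<sqsubseteq> y"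
    using le x refl unfolding specialization_le_iff openin_scott_topology by blast
  then show "x \<in> carrier L \<and> y \<in> carrier L \<and> x \<sqsubseteq> y"
    using x y scott_open_not_le by blast
next
  assume "x \<in> carrier L \<and> y \<in> carrier L \<and> x \<sqsubseteq> y"
  then show "specialization_le (scott_topology L) x y"
    unfolding specialization_le_iff topspace_scott_topology openin_scott_topology scott_open_def
    by blast
qed

text \<open>A directed set meets every Scott open neighbourhood of its supremum, so it converges to
  it; directed-openness therefore yields the Scott condition. This makes \<Sigma>\<O>(X) an
  admissible factor in condition (2).\<close>

lemma directed_space_scott_topology: "directed_space (scott_topology L)"
  unfolding directed_space_def
proof (intro conjI allI impI)
  show "t0_space (scott_topology L)"
    unfolding t0_space_def topspace_scott_topology
  proof (intro ballI impI)
    fix x y assume xy: "x \<in> carrier L" "y \<in> carrier L" "x \<noteq> y"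
    then consider "\<not> x \<sqsubseteq> y" | "\<not> y \<sqsubseteq> x"
      using le_antisym by (auto simp: eq_is_equal)
    then show "\<exists>U. openin (scott_topology L) U \<and> (x \<notin> U) = (y \<in> U)"
    proof cases
      case 1
      then show ?thesis
        using xy scott_open_not_le[of y] le_refl
        by (intro exI[of _ "{z \<in> carrier L. \<not> z \<sqsubseteq> y}"]) (auto simp: openin_scott_topology)
    next
      case 2
      then show ?thesis
        using xy scott_open_not_le[of x] le_refl
        by (intro exI[of _ "{z \<in> carrier L. \<not> z \<sqsubseteq> x}"]) (auto simp: openin_scott_topology)
    qed
  qed
next
  fix U assume U: "directed_open (scott_topology L) U"
  show "openin (scott_topology L) U"
    unfolding openin_scott_topology scott_open_def
  proof (intro conjI allI impI ballI)
    show sub: "U \<subseteq> carrier L"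
      using U by (simp add: directed_open_def topspace_scott_topology)
    show "y \<in> U" if "x \<in> U" "y \<in> carrier L" "x \<sqsubseteq> y" for x y
      using directed_open_upward[OF U that(1)] that sub
      by (auto simp: specialization_le_scott_topology topspace_scott_topology)
  next
    fix D s assume *: "order_directed L D \<and> is_lub L s D \<and> s \<in> U"
    then have "directed_subset (scott_topology L) D"
      unfolding order_directed_def directed_subset_def topspace_scott_topology
        specialization_le_scott_topology by (meson subsetD)
    moreover have "converges_to (scott_topology L) D s"
      using * U unfolding converges_to_def topspace_scott_topology openin_scott_topology
        scott_open_def directed_open_def by blast
    ultimately show "D \<inter> U \<noteq> {}"
      using * U unfolding directed_open_def by blast
  qed
qed

end

section \<open>The lattice of open sets\<close>

lemma carrier_open_lattice [simp]: "carrier (open_lattice X) = {U. openin X U}"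
  and le_open_lattice [simp]: "U \<sqsubseteq>\<^bsub>open_lattice X\<^esub> V \<longleftrightarrow> U \<subseteq> V"
  and eq_open_lattice [simp]: "U .=\<^bsub>open_lattice X\<^esub> V \<longleftrightarrow> U = V"
  by (simp_all add: open_lattice_def)

lemma partial_order_open_lattice: "partial_order (open_lattice X)"
  by unfold_locales (auto simp: open_lattice_def)

lemma is_lub_open_lattice_Union:
  "\<forall>U\<in>D. openin X U \<Longrightarrow> is_lub (open_lattice X) (\<Union>D) D"
  by (auto simp: least_def Upper_def)

lemma is_lub_open_lattice_iff:
  assumes "\<forall>U\<in>D. openin X U"
  shows "is_lub (open_lattice X) S D \<longleftrightarrow> S = \<Union>D"
  using is_lub_open_lattice_Union[OF assms] partial_order.least_unique[OF partial_order_open_lattice]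
  by blast

lemma complete_lattice_open_lattice: "complete_lattice (open_lattice X)"
proof -
  interpret partial_order "open_lattice X"
    by (rule partial_order_open_lattice)
  show ?thesis
  proof
    fix A assume A: "A \<subseteq> carrier (open_lattice X)"
    show "\<exists>s. is_lub (open_lattice X) s A"
      using A is_lub_open_lattice_Union[of A X] by auto
    \<comment> \<open>Intersections need not be open, so the infimum is the largest open set inside
      all members; for empty \<open>A\<close> it is the whole space.\<close>
    have "is_glb (open_lattice X) (\<Union>{U. openin X U \<and> (\<forall>V\<in>A. U \<subseteq> V)}) A"
      using A by (auto simp: greatest_def Lower_def)
    then show "\<exists>i. is_glb (open_lattice X) i A"
      by blast
  qed
qed

section \<open>The way-below relation on open sets and interpolation\<close>

lemma way_below_open_lattice:
  "way_below (open_lattice X) U V \<longleftrightarrow>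
     (\<forall>D. order_directed (open_lattice X) D \<and> V \<subseteq> \<Union>D \<longrightarrow> (\<exists>W\<in>D. U \<subseteq> W))"
  unfolding way_below_def le_open_lattice
proof (intro arg_cong[where f = All] ext iffI allI impI)
  fix D
  assume *: "\<forall>s. order_directed (open_lattice X) D \<and> is_lub (open_lattice X) s D \<and> V \<subseteq> s
      \<longrightarrow> (\<exists>W\<in>D. U \<subseteq> W)"
    and D: "order_directed (open_lattice X) D \<and> V \<subseteq> \<Union>D"
  moreover from D have "is_lub (open_lattice X) (\<Union>D) D"
    by (intro is_lub_open_lattice_Union) (auto simp: order_directed_def)
  ultimately show "\<exists>W\<in>D. U \<subseteq> W"
    by blast
next
  fix D s
  assume "order_directed (open_lattice X) D \<and> V \<subseteq> \<Union>D \<longrightarrow> (\<exists>W\<in>D. U \<subseteq> W)"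
    "order_directed (open_lattice X) D \<and> is_lub (open_lattice X) s D \<and> V \<subseteq> s"
  then show "\<exists>W\<in>D. U \<subseteq> W"
    using is_lub_open_lattice_iff[of D X s] by (auto simp: order_directed_def)
qed

lemma way_below_open_lattice_mono:
  "\<lbrakk>way_below (open_lattice X) U V; U' \<subseteq> U; V \<subseteq> V'\<rbrakk> \<Longrightarrow> way_below (open_lattice X) U' V'"
  unfolding way_below_open_lattice by (meson subset_trans)

lemma way_below_open_lattice_Un:
  assumes "way_below (open_lattice X) U W" "way_below (open_lattice X) V W"
  shows "way_below (open_lattice X) (U \<union> V) W"
  unfolding way_below_open_lattice
proof (intro allI impI)
  fix D assume D: "order_directed (open_lattice X) D \<and> W \<subseteq> \<Union>D"
  then obtain A B where "A \<in> D" "B \<in> D" "U \<subseteq> A" "V \<subseteq> B"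
    using assms unfolding way_below_open_lattice by meson
  moreover then obtain C where "C \<in> D" "A \<subseteq> C" "B \<subseteq> C"
    using D unfolding order_directed_def le_open_lattice by meson
  ultimately show "\<exists>W\<in>D. U \<union> V \<subseteq> W"
    by blast
qed

lemma way_below_open_lattice_empty: "way_below (open_lattice X) {} V"
  unfolding way_below_open_lattice order_directed_def by blast

lemma way_below_imp_subset:
  assumes "way_below (open_lattice X) U V" "openin X V"
  shows "U \<subseteq> V"
proof -
  have "order_directed (open_lattice X) {V}"
    using assms(2) by (auto simp: order_directed_def)
  then show ?thesis
    using assms(1) unfolding way_below_open_lattice by blast
qed

text \<open>Suprema are unions, and everything way below \<open>W\<close> is contained in
  \<open>W\<close>. Continuity thus says that the open sets way below \<open>W\<close> cover it,
  which is read point by point.\<close>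

lemma core_compact_iff:
  "core_compact X \<longleftrightarrow>
     (\<forall>W x. openin X W \<and> x \<in> W \<longrightarrow> (\<exists>U. openin X U \<and> x \<in> U \<and> way_below (open_lattice X) U W))"
proof -
  have "is_lub (open_lattice X) W {U. openin X U \<and> way_below (open_lattice X) U W} \<longleftrightarrow>
      (\<forall>x\<in>W. \<exists>U. openin X U \<and> x \<in> U \<and> way_below (open_lattice X) U W)" if "openin X W" for W
  proof -
    have "\<Union>{U. openin X U \<and> way_below (open_lattice X) U W} \<subseteq> W"
      using way_below_imp_subset that by blast
    then show ?thesis
      by (subst is_lub_open_lattice_iff) blast+
  qed
  then show ?thesis
    by (simp add: core_compact_def continuous_lattice_def complete_lattice_open_lattice) blast
qed

text \<open>The open sets lying two way-below steps under \<open>W\<close> form a directed family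
  covering \<open>W\<close>. Since \<open>U\<close> is way below \<open>W\<close>, some member of
  the family contains \<open>U\<close>, and its intermediate set interpolates.\<close>

lemma way_below_interpolation:
  assumes cc: "core_compact X" and W: "openin X W" and U: "way_below (open_lattice X) U W"
  obtains V where "openin X V" "way_below (open_lattice X) U V" "way_below (open_lattice X) V W"
proof -
  define D where "D = {A. openin X A \<and>
    (\<exists>B. openin X B \<and> way_below (open_lattice X) A B \<and> way_below (open_lattice X) B W)}"
  \<comment> \<open>Directedness: the union of the two intermediate sets is an intermediate set for
    the union.\<close>
  have Un: "A1 \<union> A2 \<in> D" if A: "A1 \<in> D" "A2 \<in> D" for A1 A2
  proof -
    obtain B1 B2 where B: "openin X A1" "openin X A2" "openin X B1" "openin X B2"
      "way_below (open_lattice X) A1 B1" "way_below (open_lattice X) A2 B2"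
      "way_below (open_lattice X) B1 W" "way_below (open_lattice X) B2 W"
      using A unfolding D_def by blast
    have "way_below (open_lattice X) (A1 \<union> A2) (B1 \<union> B2)"
      using way_below_open_lattice_mono[OF B(5) subset_refl Un_upper1]
        way_below_open_lattice_mono[OF B(6) subset_refl Un_upper2] way_below_open_lattice_Un
      by blast
    moreover have "way_below (open_lattice X) (B1 \<union> B2) W"
      using B(7,8) by (rule way_below_open_lattice_Un)
    ultimately show ?thesis
      using openin_Un[OF B(1,2)] openin_Un[OF B(3,4)] unfolding D_def by blast
  qed
  have "{} \<in> D"
    using way_below_open_lattice_empty openin_empty unfolding D_def by blast
  then have "order_directed (open_lattice X) D"
    unfolding order_directed_def carrier_open_lattice le_open_lattice
  proof (intro conjI ballI)
    show "D \<subseteq> {U. openin X U}"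
      unfolding D_def by blast
    show "\<exists>C\<in>D. A \<subseteq> C \<and> B \<subseteq> C" if "A \<in> D" "B \<in> D" for A B
      using Un[OF that] by blast
  qed blast
  \<comment> \<open>Each point is reached by applying core compactness twice, first inside
    \<open>W\<close> and then inside \<open>B\<close>.\<close>
  moreover have "W \<subseteq> \<Union>D"
  proof
    fix x assume "x \<in> W"
    then obtain B where B: "openin X B" "x \<in> B" "way_below (open_lattice X) B W"
      using cc W unfolding core_compact_iff by blast
    then obtain A where "openin X A" "x \<in> A" "way_below (open_lattice X) A B"
      using cc unfolding core_compact_iff by blast
    then show "x \<in> \<Union>D"
      using B unfolding D_def by blast
  qed
  ultimately obtain A where "A \<in> D" "U \<subseteq> A"
    using U unfolding way_below_open_lattice by meson
  moreover then obtain B where "openin X B" "way_below (open_lattice X) A B"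
    "way_below (open_lattice X) B W"
    unfolding D_def by blast
  ultimately show ?thesis
    using that way_below_open_lattice_mono[of X A B U B] by blast
qed

text \<open>Interpolate \<open>V\<close> between \<open>U\<close> and a directed union
  \<open>S\<close>: some member of the family contains \<open>V\<close>, so \<open>U\<close> is way
  below that member.\<close>

lemma scott_open_way_above:
  assumes "core_compact X"
  shows "scott_open (open_lattice X) {V. openin X V \<and> way_below (open_lattice X) U V}"
  unfolding scott_open_def
proof (intro conjI allI impI ballI)
  fix D S
  assume "order_directed (open_lattice X) D \<and> is_lub (open_lattice X) S D
    \<and> S \<in> {V. openin X V \<and> way_below (open_lattice X) U V}"
  then have D: "order_directed (open_lattice X) D" "\<forall>V\<in>D. openin X V" "S = \<Union>D"
    and S: "openin X S" "way_below (open_lattice X) U S"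
    using is_lub_open_lattice_iff[of D X S] by (auto simp: order_directed_def)
  obtain V where V: "openin X V" "way_below (open_lattice X) U V" "way_below (open_lattice X) V S"
    using way_below_interpolation[OF assms S] .
  then obtain W where "W \<in> D" "V \<subseteq> W"
    using D unfolding way_below_open_lattice by blast
  then have "W \<in> {V. openin X V \<and> way_below (open_lattice X) U V}"
    using V(2) D(2) way_below_open_lattice_mono[of X U V U W] by blast
  then show "D \<inter> {V. openin X V \<and> way_below (open_lattice X) U V} \<noteq> {}"
    using \<open>W \<in> D\<close> by blast
next
  fix V W
  assume "V \<in> {V. openin X V \<and> way_below (open_lattice X) U V}" "W \<in> carrier (open_lattice X)"
    "V \<sqsubseteq>\<^bsub>open_lattice X\<^esub> W"
  then show "W \<in> {V. openin X V \<and> way_below (open_lattice X) U V}"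
    using way_below_open_lattice_mono[of X U V U W] by simp
qed auto

section \<open>Core compactness and products\<close>

lemma openin_slice_fst:
  assumes "directed_space X" "directed_open (prod_topology X Y) W" "y \<in> topspace Y"
  shows "openin X {x. (x, y) \<in> W}"
proof -
  have cont: "continuous_map X (prod_topology X Y) (\<lambda>x. (x, y))"
    using assms(3) by (simp add: continuous_map_pairwise o_def)
  have "openin X {x \<in> topspace X. (x, y) \<in> W}"
    using directed_open_vimage[OF cont assms(2)] assms(1) by (simp add: directed_space_def)
  moreover have "{x \<in> topspace X. (x, y) \<in> W} = {x. (x, y) \<in> W}"
    using assms(2) by (auto simp: directed_open_def)
  ultimately show ?thesis
    by simp
qed

text \<open>As \<open>Y\<close> is directed, it is enough that the preimage of a Scott open
  \<open>H\<close> is directed-open. If \<open>D\<close> converges to \<open>y\<close>, the slices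
  over \<open>D\<close> form a directed family whose union contains the slice at \<open>y\<close>,
  so one of them lies in \<open>H\<close>.\<close>

lemma continuous_map_slice_scott:
  assumes X: "directed_space X" and Y: "directed_space Y"
    and W: "directed_open (prod_topology X Y) W"
  shows "continuous_map Y (scott_topology (open_lattice X)) (\<lambda>y. {x. (x, y) \<in> W})"
  unfolding continuous_map_def topspace_scott_topology openin_scott_topology
proof (intro conjI allI impI)
  show "(\<lambda>y. {x. (x, y) \<in> W}) \<in> topspace Y \<rightarrow> carrier (open_lattice X)"
    using openin_slice_fst[OF X W] by simp
next
  fix H assume H: "scott_open (open_lattice X) H"
  have "directed_open Y {y \<in> topspace Y. {x. (x, y) \<in> W} \<in> H}"
    unfolding directed_open_def
  proof (intro conjI allI impI)
    fix D y
    assume "directed_subset Y D \<and> converges_to Y D y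
      \<and> y \<in> {y \<in> topspace Y. {x. (x, y) \<in> W} \<in> H}"
    then have D: "directed_subset Y D" "converges_to Y D y"
      and y: "y \<in> topspace Y" "{x. (x, y) \<in> W} \<in> H"
      by auto
    have Dsub: "D \<subseteq> topspace Y"
      using D by (simp add: directed_subset_def)
    have cont: "continuous_map Y (prod_topology X Y) (\<lambda>y. (x, y))" if "x \<in> topspace X" for x
      using that by (simp add: continuous_map_pairwise o_def)
    have Wsub: "x \<in> topspace X" if "(x, z) \<in> W" for x z
      using W that by (auto simp: directed_open_def)
    define E where "E = (\<lambda>y. {x. (x, y) \<in> W}) ` D"
    \<comment> \<open>For fixed \<open>x\<close> the continuous map
      \<open>\<lambda>y. (x, y)\<close> preserves the specialization order, and \<open>W\<close> is
      upward closed.\<close>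
    have mono: "{x. (x, c) \<in> W} \<subseteq> {x. (x, d) \<in> W}"
      if "specialization_le Y c d" "d \<in> D" for c d
    proof clarify
      fix x assume x: "(x, c) \<in> W"
      have "d \<in> topspace Y"
        using that Dsub by blast
      with specialization_le_continuous_map[OF cont[OF Wsub[OF x]] that(1)]
      show "(x, d) \<in> W"
        using directed_open_upward[OF W x] Wsub[OF x] by simp
    qed
    have E: "order_directed (open_lattice X) E"
      unfolding order_directed_def
    proof (intro conjI ballI)
      show "E \<subseteq> carrier (open_lattice X)"
        using openin_slice_fst[OF X W] Dsub by (auto simp: E_def)
      show "E \<noteq> {}"
        using D by (simp add: E_def directed_subset_def)
      fix A B assume "A \<in> E" "B \<in> E"
      then obtain a b where "a \<in> D" "b \<in> D"
        and AB: "A = {x. (x, a) \<in> W}" "B = {x. (x, b) \<in> W}"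
        unfolding E_def by blast
      then obtain d where "d \<in> D" "specialization_le Y a d" "specialization_le Y b d"
        using D unfolding directed_subset_def by meson
      then show "\<exists>C\<in>E. A \<sqsubseteq>\<^bsub>open_lattice X\<^esub> C \<and> B \<sqsubseteq>\<^bsub>open_lattice X\<^esub> C"
        using mono[of a d] mono[of b d] unfolding AB le_open_lattice E_def by blast
    qed
    then have EO: "\<forall>U\<in>E. openin X U"
      by (auto simp: order_directed_def)
    \<comment> \<open>For each such \<open>x\<close> the slice of \<open>W\<close> in the other
      direction is directed-open and contains \<open>y\<close>, so \<open>D\<close> meets
      it.\<close>
    have "{x. (x, y) \<in> W} \<subseteq> \<Union>E"
    proof clarify
      fix x assume x: "(x, y) \<in> W"
      have "directed_open Y {z \<in> topspace Y. (x, z) \<in> W}"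
        using directed_open_vimage[OF cont[OF Wsub[OF x]] W] .
      from directed_openD[OF this D] x y obtain d where "d \<in> D" "(x, d) \<in> W"
        by blast
      then show "x \<in> \<Union>E"
        unfolding E_def by blast
    qed
    moreover have "openin X (\<Union>E)"
      using EO by (simp add: openin_Union)
    ultimately have "\<Union>E \<in> H"
      using H y(2) unfolding scott_open_def carrier_open_lattice le_open_lattice by blast
    with E have "E \<inter> H \<noteq> {}"
      using H is_lub_open_lattice_Union[OF EO] unfolding scott_open_def by blast
    then show "D \<inter> {y \<in> topspace Y. {x. (x, y) \<in> W} \<in> H} \<noteq> {}"
      using Dsub unfolding E_def by blast
  qed auto
  then show "openin Y {y \<in> topspace Y. {x. (x, y) \<in> W} \<in> H}"
    using Y by (simp add: directed_space_def)
qed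

lemma core_compact_imp_directed_product_eq:
  assumes X: "directed_space X" "core_compact X" and Y: "directed_space Y"
  shows "directed_product X Y = prod_topology X Y"
  unfolding directed_product_def directed_topology_eq_iff
proof (intro allI impI)
  fix W assume W: "directed_open (prod_topology X Y) W"
  show "openin (prod_topology X Y) W"
    unfolding openin_prod_topology_alt
  proof (intro allI impI)
    fix x y assume xy: "(x, y) \<in> W"
    then have y: "y \<in> topspace Y"
      using W by (auto simp: directed_open_def)
    have sl: "openin X {x. (x, z) \<in> W}" if "z \<in> topspace Y" for z
      using openin_slice_fst[OF X(1) W that] .
    obtain U where U: "openin X U" "x \<in> U" "way_below (open_lattice X) U {x. (x, y) \<in> W}"
      using X(2) sl[OF y] xy unfolding core_compact_iff by blast
    \<comment> \<open>The preimage of the Scott open set of all \<open>V\<close> with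
      \<open>U\<close> way below \<open>V\<close>, under the slice map.\<close>
    define N where
      "N = {z \<in> topspace Y. {x. (x, z) \<in> W} \<in> {V. openin X V \<and> way_below (open_lattice X) U V}}"
    have "openin Y N"
      unfolding N_def
      by (rule openin_continuous_map_preimage[OF continuous_map_slice_scott[OF X(1) Y W]])
        (simp only: openin_scott_topology scott_open_way_above[OF X(2)])
    moreover have "y \<in> N"
      using y U sl unfolding N_def by blast
    moreover have "U \<times> N \<subseteq> W"
      using way_below_imp_subset unfolding N_def by blast
    ultimately show "\<exists>U V. openin X U \<and> openin Y V \<and> x \<in> U \<and> y \<in> V \<and> U \<times> V \<subseteq> W"
      using U(1,2) by (intro exI[of _ U] exI[of _ N]) blast
  qed
qed

section \<open>From products to core compactness: the membership relation\<close>

text \<open>Two elements of \<open>D\<close> are chosen in turn: \<open>(A, a)\<close> with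
  \<open>x \<in> A\<close>, then \<open>(B, b)\<close> with \<open>b \<in> A\<close>. For an upper
  bound \<open>(C, c)\<close> of both, \<open>A \<subseteq> C\<close> and \<open>c \<in> A\<close>,
  hence \<open>c \<in> C\<close>.\<close>

lemma directed_open_membership:
  "directed_open (prod_topology (scott_topology (open_lattice X)) X) {(U, x). openin X U \<and> x \<in> U}"
    (is "directed_open ?P ?E")
  unfolding directed_open_def
proof (intro conjI allI impI)
  show "?E \<subseteq> topspace ?P"
    using openin_subset by (fastforce simp: topspace_scott_topology)
next
  interpret partial_order "open_lattice X"
    by (rule partial_order_open_lattice)
  fix D p assume "directed_subset ?P D \<and> converges_to ?P D p \<and> p \<in> ?E"
  then obtain U x where D: "directed_subset ?P D" and cv: "converges_to ?P D (U, x)"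
    and U: "openin X U" "x \<in> U"
    by auto
  have mem: "openin X V \<and> v \<in> topspace X" if "(V, v) \<in> D" for V v
    using D that by (auto simp: directed_subset_def topspace_scott_topology)
  have near: "\<exists>(V, v)\<in>D. V \<in> H \<and> v \<in> N"
    if "scott_open (open_lattice X) H" "U \<in> H" "openin X N" "x \<in> N" for H N
  proof -
    have "openin ?P (H \<times> N)"
      using that by (simp add: openin_prod_Times_iff openin_scott_topology)
    then have "D \<inter> H \<times> N \<noteq> {}"
      using cv that unfolding converges_to_def by blast
    then show ?thesis
      by auto
  qed
  \<comment> \<open>A Scott neighbourhood of \<open>U\<close>: a directed union contains
    \<open>x\<close> only if one of its members does.\<close>
  have "scott_open (open_lattice X) {V. openin X V \<and> x \<in> V}"
    unfolding scott_open_def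
  proof (intro conjI allI impI ballI)
    fix E S assume *: "order_directed (open_lattice X) E \<and> is_lub (open_lattice X) S E
      \<and> S \<in> {V. openin X V \<and> x \<in> V}"
    then have "\<forall>V\<in>E. openin X V"
      by (auto simp: order_directed_def)
    then show "E \<inter> {V. openin X V \<and> x \<in> V} \<noteq> {}"
      using * is_lub_open_lattice_iff[of E X S] by auto
  qed auto
  then obtain A a where A: "(A, a) \<in> D" "x \<in> A"
    using near[of _ U] U by blast
  \<comment> \<open>Now the first coordinate is left free, and the set \<open>A\<close> just found
    serves as the neighbourhood of \<open>x\<close>.\<close>
  have "scott_open (open_lattice X) (carrier (open_lattice X))"
    by (metis openin_scott_topology openin_topspace topspace_scott_topology)
  from near[OF this, of A] obtain B b where B: "(B, b) \<in> D" "b \<in> A"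
    using U A mem[OF A(1)] by auto
  obtain C c where C: "(C, c) \<in> D" "specialization_le ?P (A, a) (C, c)"
    "specialization_le ?P (B, b) (C, c)"
    using D A B unfolding directed_subset_def by (metis surj_pair)
  have top: "(C, c) \<in> topspace ?P"
    using C D by (auto simp: directed_subset_def)
  have "A \<subseteq> C"
    using specialization_le_continuous_map[OF continuous_map_fst C(2) top]
    by (simp add: specialization_le_scott_topology)
  \<comment> \<open>The open set \<open>A\<close> is an upper set for the specialization order, and
    \<open>c\<close> lies above \<open>b \<in> A\<close>.\<close>
  moreover have "c \<in> A"
    using specialization_le_continuous_map[OF continuous_map_snd C(3) top] B(2) mem[OF A(1)]
    by (auto simp: specialization_le_iff)
  ultimately have "(C, c) \<in> ?E"
    using mem C by auto
  then show "D \<inter> ?E \<noteq> {}"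
    using C by blast
qed

lemma core_compact_if_scott_product_eq:
  assumes "directed_product (scott_topology (open_lattice X)) X
    = prod_topology (scott_topology (open_lattice X)) X"
  shows "core_compact X"
  unfolding core_compact_iff
proof (intro allI impI)
  fix U x assume U: "openin X U \<and> x \<in> U"
  have "openin (prod_topology (scott_topology (open_lattice X)) X) {(U, x). openin X U \<and> x \<in> U}"
    using assms directed_open_membership[of X]
    unfolding directed_product_def directed_topology_eq_iff by simp
  then have "\<exists>H V. scott_open (open_lattice X) H \<and> openin X V \<and> U \<in> H \<and> x \<in> V
      \<and> H \<times> V \<subseteq> {(U, x). openin X U \<and> x \<in> U}"
    using U unfolding openin_prod_topology_alt openin_scott_topology by simp
  then obtain H V where HV: "scott_open (open_lattice X) H" "openin X V" "U \<in> H" "x \<in> V"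
    "H \<times> V \<subseteq> {(U, x). openin X U \<and> x \<in> U}"
    by blast
  have up: "T \<in> H" if "openin X T" "U \<subseteq> T" for T
    using HV(1,3) that by (auto simp: scott_open_def)
  have meets: "D \<inter> H \<noteq> {}"
    if "order_directed (open_lattice X) D" "is_lub (open_lattice X) S D" "S \<in> H" for D S
    using HV(1) that unfolding scott_open_def by blast
  have "way_below (open_lattice X) V U"
    unfolding way_below_open_lattice
  proof (intro allI impI)
    fix D assume D: "order_directed (open_lattice X) D \<and> U \<subseteq> \<Union>D"
    then have DO: "\<forall>W\<in>D. openin X W"
      by (auto simp: order_directed_def)
    \<comment> \<open>The union contains \<open>U\<close>, so it lies in the upper set
      \<open>H\<close>; Scott openness then puts some member of \<open>D\<close> into
      \<open>H\<close>, and the rectangle forces \<open>V\<close> to lie inside that member.\<close>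
    then have "\<Union>D \<in> H"
      using up[of "\<Union>D"] D by (simp add: openin_Union)
    then obtain W where "W \<in> D" "W \<in> H"
      using meets[OF _ is_lub_open_lattice_Union[OF DO]] D by blast
    then show "\<exists>W\<in>D. V \<subseteq> W"
      using HV(5) by blast
  qed
  then show "\<exists>V. openin X V \<and> x \<in> V \<and> way_below (open_lattice X) V U"
    using HV(2,4) by blast
qed

text \<open>HOL cannot quantify over types, so condition (2) is stated for spaces over an arbitrary
  type \<open>'b\<close> and for spaces over \<open>'a set\<close>. The second type carries
  \<Sigma>\<O>(X), the instance from which core compactness is recovered.\<close>

theorem theorem5p5:
  fixes X :: "'a topology"
  assumes "directed_space X"
  shows "(core_compact X \<longleftrightarrow>
            (\<forall>Y :: 'b topology. directed_space Y \<longrightarrow> directed_product X Y = prod_topology X Y) \<and>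
            (\<forall>Y :: 'a set topology. directed_space Y \<longrightarrow> directed_product X Y = prod_topology X Y)) \<and>
         (core_compact X \<longleftrightarrow>
            prod_topology (scott_topology (open_lattice X)) X =
            directed_product (scott_topology (open_lattice X)) X)"
proof -
  have scott: "directed_space (scott_topology (open_lattice X))"
    by (rule partial_order.directed_space_scott_topology[OF partial_order_open_lattice])
  note cc = core_compact_imp_directed_product_eq[OF assms]
  \<comment> \<open>Condition (2) is instantiated at \<Sigma>\<O>(X); exchanging the factors turns
    it into condition (3).\<close>
  have "core_compact X"
    if "directed_product X (scott_topology (open_lattice X))
      = prod_topology X (scott_topology (open_lattice X))"
    using core_compact_if_scott_product_eq[OF directed_product_commute[OF that]] .
  then show ?thesis
    using cc scott directed_product_commute[OF cc[OF _ scott]]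
      core_compact_if_scott_product_eq[of X] by metis
qed

end
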